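(* Let $X,Y$ be complex Banach spaces and let $A\in\mathcal{L}(X,Y)$ and $B,C\in\mathcal{L}(Y,X)$ be such that $A(BA)^2=ABACA=ACABA=(AC)^2A$. Then $AC-I$ is Fredholm if and only if $BA-I$ is Fredholm. In other words, $$\sigma_e(AC)\setminus\{0\}=\sigma_e(BA)\setminus\{0\}.$$
   Context: $\mathcal{L}(X,Y)$ is the set of bounded linear operators from $X$ to $Y$, and $\mathcal{L}(X)=\mathcal{L}(X,X)$. An operator $T\in\mathcal{L}(X)$ is Fredholm if its null space is finite-dimensional and its range has finite codimension in $X$. The essential spectrum is $\sigma_e(T)=\{\lambda\in\mathbb{C}: T-\lambda\text{ is not Fredholm}\}$. *)

theory Defs
  imports "HOL-Analysis.Analysis"
begin

class complex_normed_vector = real_normed_vector +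
  fixes scaleC :: "complex \<Rightarrow> 'a \<Rightarrow> 'a"  (infixr "*\<^sub>C" 75)
  assumes scaleC_add_right: "a *\<^sub>C (x + y) = a *\<^sub>C x + a *\<^sub>C y"
    and scaleC_add_left: "(a + b) *\<^sub>C x = a *\<^sub>C x + b *\<^sub>C x"
    and scaleC_scaleC: "a *\<^sub>C (b *\<^sub>C x) = (a * b) *\<^sub>C x"
    and scaleC_one: "1 *\<^sub>C x = x"
    and scaleR_scaleC: "r *\<^sub>R x = complex_of_real r *\<^sub>C x"
    and norm_scaleC: "norm (a *\<^sub>C x) = cmod a * norm x"

class complex_banach = complex_normed_vector + complete_space

instantiation complex :: complex_banach
begin

definition scaleC_complex :: "complex \<Rightarrow> complex \<Rightarrow> complex"
  where "scaleC_complex a x = a * x"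

instance
  by standard (simp_all add: scaleC_complex_def algebra_simps norm_mult scaleR_conv_of_real)

end

global_interpretation complex_vector:
  vector_space "scaleC :: complex \<Rightarrow> 'a \<Rightarrow> 'a::complex_normed_vector"
  defines csubspace = complex_vector.subspace
    and cspan = complex_vector.span
  by standard (simp_all add: scaleC_add_right scaleC_add_left scaleC_scaleC scaleC_one)

definition bounded_clinear ::
    "('a::complex_normed_vector \<Rightarrow> 'b::complex_normed_vector) \<Rightarrow> bool"
  where "bounded_clinear f \<longleftrightarrow> bounded_linear f \<and> (\<forall>c x. f (c *\<^sub>C x) = c *\<^sub>C f x)"

definition finite_cdim :: "'a::complex_normed_vector set \<Rightarrow> bool"
  where "finite_cdim S \<longleftrightarrow> (\<exists>F. finite F \<and> cspan F = S)"

text \<open>For a subspace \<open>S\<close>: the cosets of finitely many vectors span the quotient by \<open>S\<close>.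
  The subspace \<open>S\<close> is not required to be closed.\<close>

definition finite_ccodim :: "'a::complex_normed_vector set \<Rightarrow> bool"
  where "finite_ccodim S \<longleftrightarrow> (\<exists>F. finite F \<and> (\<forall>x. \<exists>y\<in>cspan F. x - y \<in> S))"

definition fredholm :: "('a::complex_normed_vector \<Rightarrow> 'a) \<Rightarrow> bool"
  where "fredholm T \<longleftrightarrow>
    bounded_clinear T \<and> finite_cdim {x. T x = 0} \<and> finite_ccodim (range T)"

definition essential_spectrum :: "('a::complex_normed_vector \<Rightarrow> 'a) \<Rightarrow> complex set"
  where "essential_spectrum T = {l. \<not> fredholm (\<lambda>x. T x - l *\<^sub>C x)}"

end

theory Submission
  imports Defs
begin

text \<open>Put \<open>P = AC\<close> and \<open>Q = AB\<close>, both operators on \<open>Y\<close>, and let \<open>\<lambda> \<noteq> 0\<close>. The hypotheses say that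
  \<open>QQA = QPA = PQA = PPA\<close>. Since \<open>P\<close> and \<open>Q\<close> both factor through \<open>A\<close> on the left, any two words
  of length three in \<open>P\<close> and \<open>Q\<close> with the same last letter are equal. Consequently \<open>P\<close> and \<open>Q\<close> have
  the same eigenvectors for \<open>\<lambda>\<close>, and \<open>P\<close> induces a surjection from the cokernel of \<open>P - \<lambda>\<close> onto
  that of \<open>Q - \<lambda>\<close>, as \<open>Q\<close> does in the other direction. Hence \<open>AC - \<lambda>\<close> is Fredholm iff \<open>AB - \<lambda>\<close>
  is (\<open>fredholm_shift_cubic_words\<close>). The passage from \<open>AB - \<lambda>\<close> to \<open>BA - \<lambda>\<close> is Jacobson's lemma for
  Fredholm operators (\<open>fredholm_shift_swap\<close>).

  Both steps apply one principle (\<open>fredholm_transfer\<close>). If a map \<open>J\<close> carries the kernel and the range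
  of \<open>T\<close> into those of \<open>S\<close>, and \<open>J\<close> has a right inverse \<open>K\<close> on the kernels and on the cokernels,
  then the kernel and the cokernel of \<open>S\<close> are linear images of those of \<open>T\<close>. The argument is purely
  algebraic, because finite codimension of the range does not involve closedness.\<close>

section \<open>Bounded complex-linear maps\<close>

lemma
  assumes "bounded_clinear f"
  shows bounded_clinear_add: "f (x + y) = f x + f y"
    and bounded_clinear_diff: "f (x - y) = f x - f y"
    and bounded_clinear_minus: "f (- x) = - f x"
    and bounded_clinear_scaleC: "f (c *\<^sub>C x) = c *\<^sub>C f x"
  using assms
  by (auto simp: bounded_clinear_def linear_simps)

lemma bounded_clinear_compose:
  assumes "bounded_clinear f" and "bounded_clinear g"
  shows "bounded_clinear (f \<circ> g)"
  using assms
  by (auto simp: bounded_clinear_def o_def intro: bounded_linear_compose)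

lemma bounded_linear_scaleC_right:
  "bounded_linear (\<lambda>x::'a::complex_normed_vector. c *\<^sub>C x)"
proof (rule bounded_linear_intro)
  show "c *\<^sub>C (r *\<^sub>R x) = r *\<^sub>R (c *\<^sub>C x)" for r and x :: 'a
    by (simp add: scaleR_scaleC scaleC_scaleC mult.commute)
  show "norm (c *\<^sub>C x) \<le> norm x * cmod c" for x :: 'a
    by (simp add: norm_scaleC mult.commute)
qed (rule scaleC_add_right)

lemma bounded_clinear_scaleC_fun:
  assumes "bounded_clinear f"
  shows "bounded_clinear (\<lambda>x. c *\<^sub>C f x)"
  using assms bounded_linear_compose[OF bounded_linear_scaleC_right, of f]
  by (simp add: bounded_clinear_def scaleC_scaleC mult.commute)

lemma bounded_clinear_shift:
  assumes "bounded_clinear f"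
  shows "bounded_clinear (\<lambda>x. f x - c *\<^sub>C x)"
  using assms
  by (simp add: bounded_clinear_def bounded_linear_sub bounded_linear_scaleC_right
      complex_vector.scale_right_diff_distrib scaleC_scaleC mult.commute)

lemma bounded_clinear_image_cspan:
  assumes "bounded_clinear f"
  shows "f ` cspan F = cspan (f ` F)"
proof -
  interpret f: Vector_Spaces.linear scaleC scaleC f
    by unfold_locales (simp_all add: bounded_clinear_add[OF assms] bounded_clinear_scaleC[OF assms])
  show ?thesis
    using f.span_image[of F] by (simp add: cspan_def)
qed

section \<open>Transfer of the Fredholm property\<close>

text \<open>The kernel of \<open>S\<close> is the \<open>J\<close>-image of the kernel of \<open>T\<close>, and \<open>J\<close> induces a surjection of the
  cokernels, because \<open>J \<circ> K\<close> is the identity on the kernel of \<open>S\<close> and modulo the range of \<open>S\<close>. The map \<open>K\<close>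
  only chooses preimages, so it may be any function.\<close>

lemma fredholm_transfer:
  assumes T: "fredholm T" and S: "bounded_clinear S" and J: "bounded_clinear J"
    and ker_K: "\<And>x. S x = 0 \<Longrightarrow> T (K x) = 0 \<and> J (K x) = x"
    and ker_J: "\<And>y. T y = 0 \<Longrightarrow> S (J y) = 0"
    and range_J: "\<And>y. J (T y) \<in> range S"
    and range_K: "\<And>x. x - J (K x) \<in> range S"
  shows "fredholm S"
proof -
  obtain F where F: "finite F" "cspan F = {y. T y = 0}"
    using T by (auto simp: fredholm_def finite_cdim_def)
  have "{x. S x = 0} = J ` {y. T y = 0}"
    using ker_K ker_J by force
  then have "cspan (J ` F) = {x. S x = 0}"
    using bounded_clinear_image_cspan[OF J] F by metis
  then have ker: "finite_cdim {x. S x = 0}"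
    unfolding finite_cdim_def using F(1) by blast
  obtain G where G: "finite G" "\<And>y. \<exists>u\<in>cspan G. y - u \<in> range T"
    using T by (auto simp: fredholm_def finite_ccodim_def)
  have "\<exists>u\<in>cspan (J ` G). x - u \<in> range S" for x
  proof -
    obtain u z where u: "u \<in> cspan G" and z: "K x - u = T z"
      using G(2)[of "K x"] by blast
    obtain v w where v: "x - J (K x) = S v" and w: "J (T z) = S w"
      using range_K[of x] range_J[of z] by blast
    have "x - J u = (x - J (K x)) + J (K x - u)"
      by (simp add: bounded_clinear_diff[OF J])
    also have "\<dots> = S (v + w)"
      using z v w by (simp add: bounded_clinear_add[OF S])
    finally have "x - J u \<in> range S" by simp
    moreover have "J u \<in> cspan (J ` G)"
      using u bounded_clinear_image_cspan[OF J] by blast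
    ultimately show ?thesis by blast
  qed
  then have "finite_ccodim (range S)"
    unfolding finite_ccodim_def using G(1) by blast
  with S ker show ?thesis
    by (simp add: fredholm_def)
qed

section \<open>Jacobson's lemma for Fredholm operators\<close>

text \<open>Up to the factor \<open>\<lambda>\<close>, the maps \<open>A\<close> and \<open>B\<close> invert each other on the eigenspaces and on the
  cokernels, since \<open>BA\<close> acts there as \<open>\<lambda>\<close> and \<open>B(AB - \<lambda>) = (BA - \<lambda>)B\<close>.\<close>

lemma fredholm_shift_swap_imp:
  assumes A: "bounded_clinear A" and B: "bounded_clinear B" and l: "l \<noteq> 0"
    and AB: "fredholm (\<lambda>y. A (B y) - l *\<^sub>C y)"
  shows "fredholm (\<lambda>x. B (A x) - l *\<^sub>C x)"
proof -
  let ?S = "\<lambda>x. B (A x) - l *\<^sub>C x"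
  have S: "bounded_clinear ?S"
    using bounded_clinear_shift[OF bounded_clinear_compose[OF B A]] by simp
  note lin = bounded_clinear_diff[OF A] bounded_clinear_diff[OF B]
    bounded_clinear_minus[OF A] bounded_clinear_minus[OF B]
    bounded_clinear_scaleC[OF A] bounded_clinear_scaleC[OF B]
    complex_vector.scale_right_diff_distrib scaleC_scaleC scaleC_one
  show ?thesis
  proof (rule fredholm_transfer[OF AB S, where J = "\<lambda>y. (1 / l) *\<^sub>C B y" and K = A])
    show "bounded_clinear (\<lambda>y. (1 / l) *\<^sub>C B y)"
      by (rule bounded_clinear_scaleC_fun[OF B])
    show "A (B (A x)) - l *\<^sub>C A x = 0 \<and> (1 / l) *\<^sub>C B (A x) = x" if "?S x = 0" for x
      using that l by (simp add: lin)
    show "?S ((1 / l) *\<^sub>C B y) = 0" if "A (B y) - l *\<^sub>C y = 0" for y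
      using that l by (simp add: lin)
    show "(1 / l) *\<^sub>C B (A (B y) - l *\<^sub>C y) \<in> range ?S" for y
      by (rule range_eqI[where x = "(1 / l) *\<^sub>C B y"]) (use l in \<open>simp add: lin\<close>)
    show "x - (1 / l) *\<^sub>C B (A x) \<in> range ?S" for x
      by (rule range_eqI[where x = "(- 1 / l) *\<^sub>C x"]) (use l in \<open>simp add: lin\<close>)
  qed
qed

lemma fredholm_shift_swap:
  assumes "bounded_clinear A" and "bounded_clinear B" and "l \<noteq> 0"
  shows "fredholm (\<lambda>y. A (B y) - l *\<^sub>C y) \<longleftrightarrow> fredholm (\<lambda>x. B (A x) - l *\<^sub>C x)"
  using fredholm_shift_swap_imp[of A B l] fredholm_shift_swap_imp[of B A l] assms by blast

section \<open>Operators whose cubic words depend only on the last letter\<close>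

text \<open>If \<open>Qx = \<lambda>x\<close>, then \<open>\<lambda>\<^sup>2 Px = PQQx = QQQx = \<lambda>\<^sup>3 x\<close>, so \<open>Px = \<lambda>x\<close>; by symmetry the
  eigenspaces of \<open>P\<close> and \<open>Q\<close> agree. Modulo the range of \<open>Q - \<lambda>\<close>, an outermost \<open>Q\<close> acts as \<open>\<lambda>\<close>.
  There \<open>\<lambda> PQ = QPQ = QQQ = \<lambda>\<^sup>3\<close>, so \<open>PQ\<close> acts as \<open>\<lambda>\<^sup>2\<close>, and \<open>\<lambda>\<^sup>2 P = QQP = QPP = \<lambda> PP\<close>, so \<open>P\<close>
  carries the range of \<open>P - \<lambda>\<close> into that of \<open>Q - \<lambda>\<close>. Hence \<open>J = P / \<lambda>\<^sup>2\<close> and \<open>K = Q\<close> satisfy the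
  conditions of \<open>fredholm_transfer\<close>.\<close>

lemma fredholm_shift_cubic_words_imp:
  assumes P: "bounded_clinear P" and Q: "bounded_clinear Q" and l: "l \<noteq> 0"
    and QQP: "\<And>y. Q (Q (P y)) = P (P (P y))"
    and QPP: "\<And>y. Q (P (P y)) = P (P (P y))"
    and QPQ: "\<And>y. Q (P (Q y)) = Q (Q (Q y))"
    and PQQ: "\<And>y. P (Q (Q y)) = Q (Q (Q y))"
    and fredholm_P: "fredholm (\<lambda>y. P y - l *\<^sub>C y)"
  shows "fredholm (\<lambda>y. Q y - l *\<^sub>C y)"
proof -
  let ?S = "\<lambda>y. Q y - l *\<^sub>C y"
  note lin = bounded_clinear_add[OF P] bounded_clinear_add[OF Q]
    bounded_clinear_diff[OF P] bounded_clinear_diff[OF Q]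
    bounded_clinear_scaleC[OF P] bounded_clinear_scaleC[OF Q]
    complex_vector.scale_right_diff_distrib scaleC_add_right scaleC_scaleC scaleC_one
  have eigen_QP: "P x = l *\<^sub>C x" if "Q x = l *\<^sub>C x" for x
  proof -
    have "(l * l) *\<^sub>C P x = (l * l) *\<^sub>C (l *\<^sub>C x)"
      using PQQ[of x] that by (simp add: lin mult.assoc)
    then show ?thesis
      using l by (simp only: complex_vector.scale_cancel_left) simp
  qed
  have eigen_PQ: "Q x = l *\<^sub>C x" if "P x = l *\<^sub>C x" for x
  proof -
    have "(l * l) *\<^sub>C Q x = (l * l) *\<^sub>C (l *\<^sub>C x)"
      using QPP[of x] that by (simp add: lin mult.assoc)
    then show ?thesis
      using l by (simp only: complex_vector.scale_cancel_left) simp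
  qed
  show ?thesis
  proof (rule fredholm_transfer[OF fredholm_P bounded_clinear_shift[OF Q],
        where J = "\<lambda>y. (1 / l^2) *\<^sub>C P y" and K = Q])
    show "bounded_clinear (\<lambda>y. (1 / l^2) *\<^sub>C P y)"
      by (rule bounded_clinear_scaleC_fun[OF P])
    show "P (Q x) - l *\<^sub>C Q x = 0 \<and> (1 / l^2) *\<^sub>C P (Q x) = x" if "?S x = 0" for x
      using that eigen_QP[of x] l by (simp add: lin power2_eq_square)
    show "?S ((1 / l^2) *\<^sub>C P y) = 0" if "P y - l *\<^sub>C y = 0" for y
      using that eigen_PQ[of y] by (simp add: lin mult.commute)
    \<comment> \<open>The witness comes from subtracting \<open>QPP - \<lambda>PP = (Q - \<lambda>)PP\<close> from
      \<open>QQP - \<lambda>\<^sup>2 P = (Q - \<lambda>)(QP + \<lambda>P)\<close>.\<close>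
    show "(1 / l^2) *\<^sub>C P (P y - l *\<^sub>C y) \<in> range ?S" for y
      by (rule range_eqI[where x = "(1 / l^3) *\<^sub>C (Q (P y) + l *\<^sub>C P y - P (P y))"])
        (use l in \<open>simp add: lin QQP QPP power2_eq_square power3_eq_cube\<close>)
    \<comment> \<open>The witness comes from subtracting \<open>QQQ - \<lambda>\<^sup>3 = (Q - \<lambda>)(QQ + \<lambda>Q + \<lambda>\<^sup>2)\<close> from
      \<open>QPQ - \<lambda>PQ = (Q - \<lambda>)PQ\<close>.\<close>
    show "x - (1 / l^2) *\<^sub>C P (Q x) \<in> range ?S" for x
      by (rule range_eqI[where x = "(1 / l^3) *\<^sub>C (P (Q x) - Q (Q x) - l *\<^sub>C Q x - l^2 *\<^sub>C x)"])
        (use l in \<open>simp add: lin QPQ power2_eq_square power3_eq_cube\<close>)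
  qed
qed

lemma fredholm_shift_cubic_words:
  assumes "bounded_clinear P" and "bounded_clinear Q" and "l \<noteq> 0"
    and "\<And>y. Q (Q (P y)) = P (P (P y))" "\<And>y. Q (P (P y)) = P (P (P y))"
      "\<And>y. P (Q (P y)) = P (P (P y))"
    and "\<And>y. P (P (Q y)) = Q (Q (Q y))" "\<And>y. P (Q (Q y)) = Q (Q (Q y))"
      "\<And>y. Q (P (Q y)) = Q (Q (Q y))"
  shows "fredholm (\<lambda>y. P y - l *\<^sub>C y) \<longleftrightarrow> fredholm (\<lambda>y. Q y - l *\<^sub>C y)"
  using fredholm_shift_cubic_words_imp[of P Q l] fredholm_shift_cubic_words_imp[of Q P l] assms
  by metis

section \<open>The common essential spectrum away from zero\<close>

theorem corollary4p8:
  fixes A :: "'x::complex_banach \<Rightarrow> 'y::complex_banach"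
    and B C :: "'y \<Rightarrow> 'x"
  assumes "bounded_clinear A" and "bounded_clinear B" and "bounded_clinear C"
    and "A \<circ> (B \<circ> A) ^^ 2 = A \<circ> B \<circ> A \<circ> C \<circ> A"
    and "A \<circ> B \<circ> A \<circ> C \<circ> A = A \<circ> C \<circ> A \<circ> B \<circ> A"
    and "A \<circ> C \<circ> A \<circ> B \<circ> A = (A \<circ> C) ^^ 2 \<circ> A"
  shows "(fredholm (\<lambda>y. (A \<circ> C) y - y) \<longleftrightarrow> fredholm (\<lambda>x. (B \<circ> A) x - x)) \<and>
    essential_spectrum (A \<circ> C) - {0} = essential_spectrum (B \<circ> A) - {0}"
proof -
  have words:
    "A (B (A (C (A x)))) = A (B (A (B (A x))))"
    "A (C (A (B (A x)))) = A (B (A (B (A x))))"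
    "A (C (A (C (A x)))) = A (B (A (B (A x))))" for x
    using assms(4-6) by (auto simp: fun_eq_iff numeral_2_eq_2)
  have shift: "fredholm (\<lambda>y. (A \<circ> C) y - l *\<^sub>C y) \<longleftrightarrow> fredholm (\<lambda>x. (B \<circ> A) x - l *\<^sub>C x)"
    if "l \<noteq> 0" for l
  proof -
    have "fredholm (\<lambda>y. (A \<circ> C) y - l *\<^sub>C y) \<longleftrightarrow> fredholm (\<lambda>y. (A \<circ> B) y - l *\<^sub>C y)"
      using that
      by (intro fredholm_shift_cubic_words bounded_clinear_compose assms(1-3)) (simp_all add: words)
    then show ?thesis
      using fredholm_shift_swap[OF assms(1,2) that] by simp
  qed
  show ?thesis
    using shift shift[of 1] by (auto simp: essential_spectrum_def scaleC_one)
qed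

end
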